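(* Let $d\ge 2$ and $m\ge 2$, let $\mathcal X=\{X_1,\dots,X_m\}$ be a set of pairwise distinct points in $\mathbb R^d$ and $\mathbf p=\{p_1,\dots,p_m\}$ a set of $m$ nonnegative integers. Let $$I(\mathcal X,\mathbf p)=\Big\{f\in\Pi^d:\ \frac{\partial^{\alpha_1+\dots+\alpha_d}}{\partial x_1^{\alpha_1}\cdots\partial x_d^{\alpha_d}}f(X_q)=0,\ 1\le q\le m,\ 0\le|\alpha|\le p_q\Big\}.$$ Then $I(\mathcal X,\mathbf p)$ is the ideal of $\Pi^d$ generated by all polynomials $f\in\Pi^d$ such that, for each $i=1,2,\dots,m$, $f$ is divisible by a product of $p_i+1$ linear polynomials (not necessarily distinct) which vanish at $X_i$.
   Context: $\Pi^d=\mathbb R[x_1,\dots,x_d]$, and $|\alpha|=\alpha_1+\dots+\alpha_d$ for $\alpha\in\mathbb N_0^d$. A linear polynomial is a polynomial of total degree 1 (not necessarily homogeneous). *)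

theory Defs
  imports "HOL-Analysis.Analysis" "HOL-Library.Poly_Mapping"
begin

text \<open>
  Real polynomials in the variables \<open>x\<^sub>i\<close>, where \<open>i\<close> ranges over the finite type \<open>'n\<close>, so that
  the number of variables is \<open>CARD('n)\<close>. A monomial is its exponent vector
  \<open>'n \<Rightarrow>\<^sub>0 nat\<close>, and a polynomial is the finitely supported map from monomials to coefficients.
  The product of the library on this type is convolution, so this is a commutative ring with 1.
\<close>

type_synonym 'n mpoly = "('n \<Rightarrow>\<^sub>0 nat) \<Rightarrow>\<^sub>0 real"

definition abs_mi :: "('n::finite \<Rightarrow>\<^sub>0 nat) \<Rightarrow> nat" where
  "abs_mi \<alpha> = (\<Sum>i\<in>UNIV. Poly_Mapping.lookup \<alpha> i)"

text \<open>The zero polynomial gets total degree 0; this does not affect \<open>is_linear\<close>.\<close>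

definition total_degree :: "'n::finite mpoly \<Rightarrow> nat" where
  "total_degree f = Max (insert 0 (abs_mi ` Poly_Mapping.keys f))"

definition is_linear :: "'n::finite mpoly \<Rightarrow> bool" where
  "is_linear f \<longleftrightarrow> total_degree f = 1"

definition eval_mpoly :: "'n::finite mpoly \<Rightarrow> real ^ 'n \<Rightarrow> real" where
  "eval_mpoly f x =
     (\<Sum>\<beta>\<in>Poly_Mapping.keys f. Poly_Mapping.lookup f \<beta> * (\<Prod>i\<in>UNIV. x $ i ^ Poly_Mapping.lookup \<beta> i))"

text \<open>The truncated subtraction below is harmless: its coefficient vanishes if \<open>\<beta>\<^sub>i = 0\<close>.\<close>

definition partial :: "'n::finite \<Rightarrow> 'n mpoly \<Rightarrow> 'n mpoly" where
  "partial i f =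
     (\<Sum>\<beta>\<in>Poly_Mapping.keys f.
        Poly_Mapping.single (\<beta> - Poly_Mapping.single i 1)
          (real (Poly_Mapping.lookup \<beta> i) * Poly_Mapping.lookup f \<beta>))"

text \<open>
  The variables carry no order, so the composition of the partial derivatives is a fold over
  the set of variables; it is well defined by \<open>comp_fun_commute_partial\<close> below.
\<close>

definition partial_mi :: "('n::finite \<Rightarrow>\<^sub>0 nat) \<Rightarrow> 'n mpoly \<Rightarrow> 'n mpoly" where
  "partial_mi \<alpha> f = Finite_Set.fold (\<lambda>i. partial i ^^ Poly_Mapping.lookup \<alpha> i) f UNIV"

lemma lookup_partial:
  "Poly_Mapping.lookup (partial i f) \<gamma> =
     real (Suc (Poly_Mapping.lookup \<gamma> i)) * Poly_Mapping.lookup f (\<gamma> + Poly_Mapping.single i 1)"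
proof -
  let ?e = "Poly_Mapping.single i (1::nat)"
  have eq: "Poly_Mapping.lookup (Poly_Mapping.single (\<beta> - ?e)
          (real (Poly_Mapping.lookup \<beta> i) * Poly_Mapping.lookup f \<beta>)) \<gamma>
        = (if \<beta> = \<gamma> + ?e then real (Suc (Poly_Mapping.lookup \<gamma> i)) *
             Poly_Mapping.lookup f (\<gamma> + ?e) else 0)" for \<beta>
  proof (cases "Poly_Mapping.lookup \<beta> i = 0")
    case True
    then have "\<beta> \<noteq> \<gamma> + ?e"
      by (auto simp: lookup_add)
    with True show ?thesis
      by simp
  next
    case False
    then have "\<beta> - ?e = \<gamma> \<longleftrightarrow> \<beta> = \<gamma> + ?e"
      by (auto simp: poly_mapping_eq_iff fun_eq_iff lookup_add lookup_minus lookup_single when_def)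
    then show ?thesis
      by (auto simp: lookup_single when_def lookup_add)
  qed
  show ?thesis
    unfolding partial_def lookup_sum eq
    by (simp add: sum.delta in_keys_iff)
qed

lemma partial_commute: "partial i (partial j f) = partial j (partial i f)"
  by (cases "i = j", simp)
    (rule poly_mapping_eqI, simp add: lookup_partial lookup_add lookup_single add_ac mult_ac)

lemma comp_fun_commute_partial:
  "comp_fun_commute (\<lambda>i. partial i ^^ Poly_Mapping.lookup \<alpha> i)"
proof
  fix i j :: 'a
  have 1: "(partial i ^^ k) (partial j f) = partial j ((partial i ^^ k) f)" for k and f :: "'a mpoly"
    by (induction k) (auto simp: partial_commute[of i j])
  have "(partial i ^^ k) ((partial j ^^ l) f) = (partial j ^^ l) ((partial i ^^ k) f)"
    for k l and f :: "'a mpoly"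
    by (induction l) (auto simp: 1)
  then show "(partial j ^^ Poly_Mapping.lookup \<alpha> j) \<circ> (partial i ^^ Poly_Mapping.lookup \<alpha> i) =
             (partial i ^^ Poly_Mapping.lookup \<alpha> i) \<circ> (partial j ^^ Poly_Mapping.lookup \<alpha> j)"
    by (simp add: fun_eq_iff)
qed

text \<open>The formal partial derivative is the analytic one.\<close>

lemma has_real_derivative_eval_mpoly:
  "((\<lambda>t. eval_mpoly f (\<chi> k. if k = i then t else x $ k)) has_real_derivative
     eval_mpoly (partial i f) x) (at (x $ i))"
proof -
  define mon :: "('a \<Rightarrow>\<^sub>0 nat) \<Rightarrow> real" where
    "mon \<beta> = (\<Prod>i\<in>UNIV. x $ i ^ Poly_Mapping.lookup \<beta> i)" for \<beta>
  define E where "E = (\<lambda>g. \<Sum>\<beta>\<in>Poly_Mapping.keys g. Poly_Mapping.lookup g \<beta> * mon \<beta>)"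
  let ?e = "Poly_Mapping.single i (1::nat)"
  have E_eq: "E g = (\<Sum>\<beta>\<in>A. Poly_Mapping.lookup g \<beta> * mon \<beta>)"
    if "finite A" "Poly_Mapping.keys g \<subseteq> A" for A g
    unfolding E_def using that by (intro sum.mono_neutral_left) (auto simp: in_keys_iff)
  have E_add: "E (g + h) = E g + E h" for g h
    using E_eq[of "Poly_Mapping.keys g \<union> Poly_Mapping.keys h" g]
      E_eq[of "Poly_Mapping.keys g \<union> Poly_Mapping.keys h" h]
      E_eq[of "Poly_Mapping.keys g \<union> Poly_Mapping.keys h" "g + h"] keys_add[of g h]
    by (simp add: lookup_add sum.distrib algebra_simps)
  have E_sum: "E (\<Sum>b\<in>A. h b) = (\<Sum>b\<in>A. E (h b))" if "finite A" for h A
    using that by induction (auto simp: E_add, simp add: E_def)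
  have E_single: "E (Poly_Mapping.single \<beta> c) = c * mon \<beta>" for \<beta> c
    using E_eq[of "{\<beta>}" "Poly_Mapping.single \<beta> c"] by (auto split: if_splits)
  have mon_deriv: "((\<lambda>t. \<Prod>k\<in>UNIV. (if k = i then t else x $ k) ^ Poly_Mapping.lookup \<beta> k)
      has_real_derivative real (Poly_Mapping.lookup \<beta> i) * mon (\<beta> - ?e)) (at (x $ i))" for \<beta>
  proof -
    define c where "c = (\<Prod>k\<in>UNIV - {i}. x $ k ^ Poly_Mapping.lookup \<beta> k)"
    have 1: "(\<lambda>t. \<Prod>k\<in>UNIV. (if k = i then t else x $ k) ^ Poly_Mapping.lookup \<beta> k)
        = (\<lambda>t. t ^ Poly_Mapping.lookup \<beta> i * c)"
      unfolding c_def by (subst prod.remove[of _ i]) auto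
    have 2: "mon (\<beta> - ?e) = (x $ i) ^ (Poly_Mapping.lookup \<beta> i - 1) * c"
      unfolding c_def mon_def
      by (subst prod.remove[of _ i]) (auto simp: lookup_minus lookup_single intro!: prod.cong)
    show ?thesis
      unfolding 1 2 by (auto intro!: derivative_eq_intros)
  qed
  have "eval_mpoly (partial i f) x = E (partial i f)"
    by (simp add: E_def mon_def eval_mpoly_def)
  also have "\<dots> = (\<Sum>\<beta>\<in>Poly_Mapping.keys f.
      Poly_Mapping.lookup f \<beta> * (real (Poly_Mapping.lookup \<beta> i) * mon (\<beta> - ?e)))"
    unfolding partial_def by (simp add: E_sum E_single mult_ac)
  finally show ?thesis
    by (simp only: eval_mpoly_def[of f] vec_lambda_beta)
      (intro DERIV_sum DERIV_cmult mon_deriv)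
qed

text \<open>The submodules of a ring over itself are its ideals; the span of a set is the ideal
  generated by it.\<close>

global_interpretation mpoly_ideal: module "(*) :: 'n::finite mpoly \<Rightarrow> 'n mpoly \<Rightarrow> 'n mpoly"
  defines mpoly_ideal_generated = mpoly_ideal.span
  by standard (simp_all add: algebra_simps)

definition fat_point_ideal ::
    "nat \<Rightarrow> (nat \<Rightarrow> real ^ 'n::finite) \<Rightarrow> (nat \<Rightarrow> nat) \<Rightarrow> 'n mpoly set" where
  "fat_point_ideal m X p =
     {f. \<forall>q\<in>{1..m}. \<forall>\<alpha>. abs_mi \<alpha> \<le> p q \<longrightarrow> eval_mpoly (partial_mi \<alpha> f) (X q) = 0}"

definition linear_product_divisible ::
    "nat \<Rightarrow> (nat \<Rightarrow> real ^ 'n::finite) \<Rightarrow> (nat \<Rightarrow> nat) \<Rightarrow> 'n mpoly set" where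
  "linear_product_divisible m X p =
     {f. \<forall>i\<in>{1..m}. \<exists>ls. length ls = p i + 1 \<and>
           (\<forall>l\<in>set ls. is_linear l \<and> eval_mpoly l (X i) = 0) \<and> prod_list ls dvd f}"

end

theory Submission
  imports Defs
begin

text \<open>
  Write \<open>M\<^sub>a\<close> for the ideal of the polynomials that vanish at the point \<open>a\<close>; it is generated by the
  coordinate functions \<open>x\<^sub>i - a\<^sub>i\<close>. Two facts carry the theorem.

  First, a polynomial whose derivatives of order less than \<open>k\<close> vanish at \<open>a\<close> lies in \<open>M\<^sub>a\<^sup>k\<close>
  (\<open>vanishing_subset_point_power\<close>). Instead of a Taylor expansion, the proof uses the Euler
  operator \<open>E f = (\<Sum>i. (x\<^sub>i - a\<^sub>i) * partial i f)\<close>. A product of \<open>j\<close> coordinate functions is an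
  eigenvector of \<open>E\<close> for the eigenvalue \<open>j\<close>, and \<open>E\<close> is a derivation, so \<open>E g - j g\<close> lies in
  \<open>M\<^sub>a\<^sup>j\<^sup>+\<^sup>1\<close> for every \<open>g\<close> in \<open>M\<^sub>a\<^sup>j\<close>. By induction on the order of vanishing the derivatives of \<open>f\<close>
  lie in a power of \<open>M\<^sub>a\<close>, so \<open>E f\<close> lies in the next power; dividing by the eigenvalue, \<open>f\<close> climbs
  from each power of \<open>M\<^sub>a\<close> to the next up to that of \<open>E f\<close>.

  Secondly, the powers of \<open>M\<^sub>a\<close> at different points are comaximal, so that their intersection is
  their product (\<open>in_generated_if_in_all_point_powers\<close>). The product is generated by products of
  generators, that is, by products that contain \<open>p\<^sub>i + 1\<close> coordinate functions centred at \<open>X\<^sub>i\<close> for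
  each \<open>i\<close>. These are among the polynomials named in the theorem.

  The other inclusion holds because multiplication by a polynomial that vanishes at \<open>a\<close> raises the
  order of vanishing at \<open>a\<close> (\<open>mult_raises_vanishing_order\<close>).
\<close>

text \<open>As a rewrite rule, this law of modules moves the brackets of a product to the left. It would
  loop against the associativity in \<open>algebra_simps\<close>.\<close>

declare mpoly_ideal.scale_scale [simp del]

section \<open>Evaluation and partial derivatives\<close>

abbreviation Const :: "real \<Rightarrow> 'n::finite mpoly" where
  "Const c \<equiv> Poly_Mapping.single 0 c"

lemma Const_mult_Const: "Const b * Const c = Const (b * c)"
  by (simp add: mult_single)

lemma Const_power: "Const c ^ k = Const (c ^ k)"
  by (induction k) (simp_all add: mult_single)

lemma prod_Const: "finite A \<Longrightarrow> (\<Prod>i\<in>A. Const (h i)) = Const (\<Prod>i\<in>A. h i)"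
  by (induction A rule: finite_induct) (simp_all add: mult_single)

lemma eval_mpoly_superset:
  assumes "finite A" "Poly_Mapping.keys f \<subseteq> A"
  shows "eval_mpoly f x =
    (\<Sum>\<beta>\<in>A. Poly_Mapping.lookup f \<beta> * (\<Prod>i\<in>UNIV. x $ i ^ Poly_Mapping.lookup \<beta> i))"
  unfolding eval_mpoly_def using assms by (intro sum.mono_neutral_left) (auto simp: in_keys_iff)

lemma eval_mpoly_single:
  "eval_mpoly (Poly_Mapping.single \<beta> c) x = c * (\<Prod>i\<in>UNIV. x $ i ^ Poly_Mapping.lookup \<beta> i)"
  by (subst eval_mpoly_superset[of "{\<beta>}"]) (auto split: if_splits)

lemma eval_mpoly_Const [simp]: "eval_mpoly (Const c) x = c"
  by (simp add: eval_mpoly_single)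

lemma eval_mpoly_0 [simp]: "eval_mpoly 0 x = 0"
  by (simp add: eval_mpoly_def)

lemma eval_mpoly_1 [simp]: "eval_mpoly 1 x = 1"
  using eval_mpoly_Const[of 1] by simp

lemma eval_mpoly_add [simp]: "eval_mpoly (f + g) x = eval_mpoly f x + eval_mpoly g x"
  using eval_mpoly_superset[of "Poly_Mapping.keys f \<union> Poly_Mapping.keys g" f x]
    eval_mpoly_superset[of "Poly_Mapping.keys f \<union> Poly_Mapping.keys g" g x]
    eval_mpoly_superset[of "Poly_Mapping.keys f \<union> Poly_Mapping.keys g" "f + g" x] keys_add[of f g]
  by (simp add: lookup_add sum.distrib algebra_simps)

lemma eval_mpoly_diff [simp]: "eval_mpoly (f - g) x = eval_mpoly f x - eval_mpoly g x"
  using eval_mpoly_add[of "f - g" g x] by simp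

lemma poly_mapping_single_add_induct [case_names single add]:
  fixes f :: "'a \<Rightarrow>\<^sub>0 'b::monoid_add"
  assumes "\<And>\<beta> c. P (Poly_Mapping.single \<beta> c)" "\<And>f g. P f \<Longrightarrow> P g \<Longrightarrow> P (f + g)"
  shows "P f"
proof (induction f rule: update_induct)
  case const
  show ?case using assms(1)[of undefined 0] by simp
next
  case (update f \<beta> c)
  then have "Poly_Mapping.update \<beta> c f = f + Poly_Mapping.single \<beta> c"
    by (intro poly_mapping_eqI) (auto simp: lookup_update lookup_add lookup_single in_keys_iff)
  with update assms show ?case by simp
qed

lemma eval_mpoly_mult [simp]: "eval_mpoly (f * g) x = eval_mpoly f x * eval_mpoly g x"
proof (induction f rule: poly_mapping_single_add_induct)
  case (single \<beta> c)
  show ?case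
  proof (induction g rule: poly_mapping_single_add_induct)
    case (single \<gamma> d)
    show ?case
      by (simp add: mult_single eval_mpoly_single lookup_add power_add prod.distrib)
  qed (simp add: algebra_simps)
qed (simp add: algebra_simps)

lemma eval_mpoly_power [simp]: "eval_mpoly (f ^ k) x = eval_mpoly f x ^ k"
  by (induction k) simp_all

lemma eval_mpoly_prod [simp]:
  "finite A \<Longrightarrow> eval_mpoly (\<Prod>i\<in>A. h i) x = (\<Prod>i\<in>A. eval_mpoly (h i) x)"
  by (induction A rule: finite_induct) simp_all

lemma partial_0 [simp]: "partial i 0 = 0"
  by (simp add: partial_def)

lemma partial_add [simp]: "partial i (f + g) = partial i f + partial i g"
  by (rule poly_mapping_eqI) (simp add: lookup_partial lookup_add algebra_simps)

lemma partial_diff [simp]: "partial i (f - g) = partial i f - partial i g"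
  using partial_add[of i "f - g" g] by (simp add: algebra_simps)

lemma partial_single:
  "partial i (Poly_Mapping.single \<beta> c) =
     Poly_Mapping.single (\<beta> - Poly_Mapping.single i 1) (real (Poly_Mapping.lookup \<beta> i) * c)"
  by (cases "c = 0") (simp_all add: partial_def)

lemma partial_Const [simp]: "partial i (Const c) = 0"
  by (simp add: partial_single)

lemma partial_1 [simp]: "partial i 1 = 0"
  using partial_Const[of i 1] by simp

lemma partial_mult [simp]: "partial i (f * g) = partial i f * g + f * partial i g"
proof (induction f rule: poly_mapping_single_add_induct)
  case (single \<beta> c)
  show ?case
  proof (induction g rule: poly_mapping_single_add_induct)
    case (single \<gamma> d)
    let ?e = "Poly_Mapping.single i (1::nat)"
    \<comment> \<open>Where the truncated subtraction goes wrong, the coefficient in front of it is zero.\<close>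
    have shift: "(\<beta> - ?e) + \<gamma> = \<beta> + \<gamma> - ?e" "\<gamma> + (\<beta> - ?e) = \<gamma> + \<beta> - ?e" if "Poly_Mapping.lookup \<beta> i \<noteq> 0" for \<beta> \<gamma>
      using that
      by (auto simp: poly_mapping_eq_iff fun_eq_iff lookup_add lookup_minus lookup_single when_def)
    have 1: "partial i (Poly_Mapping.single \<beta> c) * Poly_Mapping.single \<gamma> d =
        Poly_Mapping.single (\<beta> + \<gamma> - ?e) (real (Poly_Mapping.lookup \<beta> i) * (c * d))"
      by (cases "Poly_Mapping.lookup \<beta> i = 0")
        (simp_all add: partial_single mult_single shift mult.assoc del: One_nat_def)
    have 2: "Poly_Mapping.single \<beta> c * partial i (Poly_Mapping.single \<gamma> d) =
        Poly_Mapping.single (\<beta> + \<gamma> - ?e) (c * (real (Poly_Mapping.lookup \<gamma> i) * d))"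
      by (cases "Poly_Mapping.lookup \<gamma> i = 0")
        (simp_all add: partial_single mult_single shift mult.assoc del: One_nat_def)
    show ?case
      unfolding 1 2
      by (simp add: mult_single partial_single lookup_add single_add[symmetric] algebra_simps)
  qed (simp add: algebra_simps)
qed (simp add: algebra_simps)

lemma partial_mi_0 [simp]: "partial_mi 0 f = f"
proof -
  have "Finite_Set.fold (\<lambda>i g. g) f (A :: 'a set) = f" if "finite A" for A
    using that
  proof (induction A rule: finite_induct)
    case (insert i A)
    interpret comp_fun_commute "\<lambda>(i::'a) g. g"
      by standard simp
    show ?case using insert by simp
  qed simp
  then show ?thesis
    by (simp add: partial_mi_def id_def)
qed

text \<open>With this recursion, orders of vanishing can be handled by induction over single partial
  derivatives, without multi-indices.\<close>

lemma partial_mi_add_single: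
  "partial_mi (\<alpha> + Poly_Mapping.single i 1) f = partial_mi \<alpha> (partial i f)"
proof -
  define F where "F = (\<lambda>\<alpha> j. partial j ^^ Poly_Mapping.lookup \<alpha> j :: 'a mpoly \<Rightarrow> 'a mpoly)"
  let ?\<alpha>' = "\<alpha> + Poly_Mapping.single i 1"
  have fold_split: "partial_mi \<beta> g = Finite_Set.fold (F \<beta>) (F \<beta> i g) (UNIV - {i})" for \<beta> g
  proof -
    interpret comp_fun_commute "F \<beta>"
      unfolding F_def by (rule comp_fun_commute_partial)
    show ?thesis
      using fold_insert2[of "UNIV - {i}" i g] by (simp add: partial_mi_def F_def insert_absorb)
  qed
  have "Finite_Set.fold (F ?\<alpha>') z (UNIV - {i}) = Finite_Set.fold (F \<alpha>) z (UNIV - {i})" for z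
  proof (rule Finite_Set.fold_cong[where S = UNIV])
    show "comp_fun_commute_on UNIV (F ?\<alpha>')" "comp_fun_commute_on UNIV (F \<alpha>)"
      using comp_fun_commute_partial unfolding F_def comp_fun_commute_def' by blast+
  qed (auto simp: F_def lookup_add lookup_single)
  moreover have "F ?\<alpha>' i f = F \<alpha> i (partial i f)"
    by (simp add: F_def lookup_add funpow_swap1)
  ultimately show ?thesis
    by (simp add: fold_split)
qed


section \<open>Vanishing to a given order\<close>

text \<open>Here \<open>k\<close> counts the orders \<open>0, \<dots>, k - 1\<close> at which all derivatives vanish, so that
  \<open>vanishing a k\<close> will match the \<open>k\<close>-th power of the maximal ideal.\<close>

fun vanishing :: "real ^ 'n::finite \<Rightarrow> nat \<Rightarrow> 'n mpoly set" where
  "vanishing a 0 = UNIV"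
| "vanishing a (Suc k) = {f. eval_mpoly f a = 0 \<and> (\<forall>i. partial i f \<in> vanishing a k)}"

lemma abs_mi_0 [simp]: "abs_mi 0 = 0"
  by (simp add: abs_mi_def)

lemma abs_mi_single [simp]: "abs_mi (Poly_Mapping.single i k) = k"
  by (simp add: abs_mi_def lookup_single when_def)

lemma abs_mi_add [simp]: "abs_mi (\<alpha> + \<beta>) = abs_mi \<alpha> + abs_mi \<beta>"
  by (simp add: abs_mi_def lookup_add sum.distrib)

lemma exponent_cases:
  obtains "\<alpha> = 0" | \<alpha>' i where "\<alpha> = \<alpha>' + Poly_Mapping.single i (1::nat)"
proof (cases "\<alpha> = 0")
  case False
  then obtain i where "Poly_Mapping.lookup \<alpha> i \<noteq> 0"
    by (auto simp: poly_mapping_eq_iff fun_eq_iff)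
  then have "\<alpha> = (\<alpha> - Poly_Mapping.single i 1) + Poly_Mapping.single i 1"
    by (auto simp: poly_mapping_eq_iff fun_eq_iff lookup_add lookup_minus lookup_single when_def)
  then show ?thesis by (rule that(2))
qed (rule that(1))

lemma vanishing_iff_partial_mi:
  "f \<in> vanishing a (Suc k) \<longleftrightarrow> (\<forall>\<alpha>. abs_mi \<alpha> \<le> k \<longrightarrow> eval_mpoly (partial_mi \<alpha> f) a = 0)"
proof (induction k arbitrary: f)
  case 0
  have "\<alpha> = 0" if "abs_mi \<alpha> = 0" for \<alpha> :: "'a \<Rightarrow>\<^sub>0 nat"
    using that by (cases \<alpha> rule: exponent_cases) auto
  then have "abs_mi \<alpha> \<le> 0 \<longleftrightarrow> \<alpha> = 0" for \<alpha> :: "'a \<Rightarrow>\<^sub>0 nat"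
    by auto
  then show ?case by simp
next
  case (Suc k)
  have "f \<in> vanishing a (Suc (Suc k)) \<longleftrightarrow> eval_mpoly f a = 0 \<and>
     (\<forall>i \<alpha>. abs_mi \<alpha> \<le> k \<longrightarrow> eval_mpoly (partial_mi (\<alpha> + Poly_Mapping.single i 1) f) a = 0)"
    unfolding vanishing.simps(2)[of a "Suc k"] partial_mi_add_single using Suc.IH by auto
  also have "\<dots> \<longleftrightarrow> (\<forall>\<alpha>. abs_mi \<alpha> \<le> Suc k \<longrightarrow> eval_mpoly (partial_mi \<alpha> f) a = 0)"
  proof safe
    fix \<alpha> :: "'a \<Rightarrow>\<^sub>0 nat"
    assume "eval_mpoly f a = 0" "abs_mi \<alpha> \<le> Suc k"
      "\<forall>i \<alpha>. abs_mi \<alpha> \<le> k \<longrightarrow> eval_mpoly (partial_mi (\<alpha> + Poly_Mapping.single i 1) f) a = 0"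
    then show "eval_mpoly (partial_mi \<alpha> f) a = 0"
      by (cases \<alpha> rule: exponent_cases) auto
  next
    assume *: "\<forall>\<alpha>. abs_mi \<alpha> \<le> Suc k \<longrightarrow> eval_mpoly (partial_mi \<alpha> f) a = 0"
    show "eval_mpoly f a = 0"
      using *[rule_format, of 0] by simp
    show "eval_mpoly (partial_mi (\<alpha> + Poly_Mapping.single i 1) f) a = 0" if "abs_mi \<alpha> \<le> k" for i \<alpha>
      using that by (intro *[rule_format]) simp
  qed
  finally show ?case .
qed

lemma vanishing_Suc_subset: "vanishing a (Suc k) \<subseteq> vanishing a k"
proof (induction k)
  case (Suc k)
  then show ?case unfolding vanishing.simps(2)[of a "Suc k"] by auto
qed simp

lemma zero_in_vanishing: "0 \<in> vanishing a k"
  by (induction k) auto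

lemma add_in_vanishing: "f \<in> vanishing a k \<Longrightarrow> g \<in> vanishing a k \<Longrightarrow> f + g \<in> vanishing a k"
  by (induction k arbitrary: f g) auto

lemma mult_in_vanishing: "f \<in> vanishing a k \<Longrightarrow> g * f \<in> vanishing a k"
proof (induction k arbitrary: f g)
  case (Suc k)
  then have "f \<in> vanishing a k"
    using vanishing_Suc_subset by blast
  with Suc show ?case
    by (auto intro!: add_in_vanishing)
qed simp

text \<open>In \<open>partial i (l * f) = partial i l * f + l * partial i f\<close> the first summand keeps the order of
  \<open>f\<close>, and in the second one the factor \<open>l\<close> makes up for the order that \<open>f\<close> loses to the
  derivative.\<close>

lemma mult_raises_vanishing_order:
  assumes "eval_mpoly l a = 0" "f \<in> vanishing a k"
  shows "l * f \<in> vanishing a (Suc k)"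
  using assms(2)
proof (induction k arbitrary: f)
  case (Suc k)
  have "partial i l * f + l * partial i f \<in> vanishing a (Suc k)" for i
  proof (rule add_in_vanishing)
    show "partial i l * f \<in> vanishing a (Suc k)"
      by (rule mult_in_vanishing) (rule Suc.prems)
    show "l * partial i f \<in> vanishing a (Suc k)"
      using Suc.prems by (intro Suc.IH) simp
  qed
  then show ?case
    using assms(1) unfolding vanishing.simps(2)[of a "Suc k"] by auto
qed (use assms(1) in auto)

lemma prod_list_in_vanishing:
  "\<forall>l\<in>set ls. eval_mpoly l a = 0 \<Longrightarrow> prod_list ls \<in> vanishing a (length ls)"
  by (induction ls) (simp, simp del: vanishing.simps add: mult_raises_vanishing_order)

lemma fat_point_ideal_eq_vanishing:
  "fat_point_ideal m X p = {f. \<forall>q\<in>{1..m}. f \<in> vanishing (X q) (Suc (p q))}"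
  unfolding fat_point_ideal_def vanishing_iff_partial_mi ..


section \<open>Powers of the maximal ideal of a point\<close>

definition coord :: "real ^ 'n::finite \<Rightarrow> 'n \<Rightarrow> 'n mpoly" where
  "coord a i = Poly_Mapping.single (Poly_Mapping.single i 1) 1 - Const (a $ i)"

text \<open>The \<open>k\<close>-th power of the maximal ideal of \<open>a\<close>. The choice of generators matters: each is a
  product of exactly \<open>k\<close> linear polynomials that vanish at \<open>a\<close>, and an eigenvector of the Euler
  operator.\<close>

definition point_power :: "real ^ 'n::finite \<Rightarrow> nat \<Rightarrow> 'n mpoly set" where
  "point_power a k = mpoly_ideal_generated {prod_list (map (coord a) js) | js. length js = k}"

text \<open>A product of two ideals is controlled by the products of their generators.\<close>

lemma mult_in_generated:
  assumes "f \<in> mpoly_ideal_generated S" "g \<in> mpoly_ideal_generated T"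
    and "\<And>s t. s \<in> S \<Longrightarrow> t \<in> T \<Longrightarrow> s * t \<in> mpoly_ideal_generated U"
  shows "f * g \<in> mpoly_ideal_generated U"
  using assms(1)
proof (induction rule: mpoly_ideal.span_induct_alt)
  case (step c s f)
  have "s * g \<in> mpoly_ideal_generated U"
    using assms(2)
  proof (induction rule: mpoly_ideal.span_induct_alt)
    case (step d t g)
    have "d * (s * t) + s * g \<in> mpoly_ideal_generated U"
      using mpoly_ideal.span_add[OF mpoly_ideal.span_scale[OF assms(3)[OF \<open>s \<in> S\<close> step(1)]] step(2)] .
    then show ?case by (simp add: algebra_simps)
  qed (simp add: mpoly_ideal.span_zero)
  then have "c * (s * g) + f * g \<in> mpoly_ideal_generated U"
    by (rule mpoly_ideal.span_add[OF mpoly_ideal.span_scale step(2)])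
  then show ?case by (simp add: algebra_simps)
qed (simp add: mpoly_ideal.span_zero)

lemma eval_coord [simp]: "eval_mpoly (coord a i) x = x $ i - a $ i"
proof -
  have "(\<Prod>j\<in>UNIV. x $ j ^ Poly_Mapping.lookup (Poly_Mapping.single i 1) j) = x $ i"
    by (subst prod.remove[of _ i]) (auto simp: lookup_single intro!: prod.neutral)
  then show ?thesis by (simp add: coord_def eval_mpoly_single)
qed

lemma partial_coord: "partial i (coord a j) = (if i = j then 1 else 0)"
  by (auto simp: coord_def partial_single lookup_single)

lemma is_linear_coord: "is_linear (coord a i)"
proof -
  have "Poly_Mapping.keys (coord a i) \<subseteq> {Poly_Mapping.single i 1, 0}"
    by (auto simp: coord_def in_keys_iff lookup_minus lookup_single when_def split: if_splits)
  moreover have "Poly_Mapping.lookup (coord a i) (Poly_Mapping.single i 1) = 1"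
    by (simp add: coord_def lookup_minus lookup_single when_def)
      (metis abs_mi_0 abs_mi_single zero_neq_one One_nat_def)
  then have "Poly_Mapping.single i 1 \<in> Poly_Mapping.keys (coord a i)"
    by (simp add: in_keys_iff)
  then have "abs_mi (Poly_Mapping.single i (1::nat)) \<in> abs_mi ` Poly_Mapping.keys (coord a i)"
    by (rule imageI)
  ultimately show ?thesis
    unfolding is_linear_def total_degree_def by (intro Max_eqI) auto
qed

lemma prod_coord_in_point_power:
  "length js = k \<Longrightarrow> prod_list (map (coord a) js) \<in> point_power a k"
  unfolding point_power_def by (rule mpoly_ideal.span_base) blast

lemma point_power_absorb: "f \<in> point_power a k \<Longrightarrow> g * f \<in> point_power a k"
  unfolding point_power_def by (rule mpoly_ideal.span_scale)

lemma point_power_0: "point_power a 0 = UNIV"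
  using point_power_absorb[OF prod_coord_in_point_power[of "[]" 0 a]] by auto

lemma mult_in_point_power:
  assumes "f \<in> point_power a j" "g \<in> point_power a k"
  shows "f * g \<in> point_power a (j + k)"
  using assms unfolding point_power_def
proof (rule mult_in_generated)
  fix s t
  assume "s \<in> {prod_list (map (coord a) js) | js. length js = j}"
    "t \<in> {prod_list (map (coord a) js) | js. length js = k}"
  then obtain u v where "s * t = prod_list (map (coord a) (u @ v))" "length (u @ v) = j + k"
    by auto
  then show "s * t \<in> mpoly_ideal_generated {prod_list (map (coord a) js) | js. length js = j + k}"
    using prod_coord_in_point_power[of "u @ v" "j + k" a] by (simp only: point_power_def)
qed

lemma point_power_add: "f \<in> point_power a k \<Longrightarrow> g \<in> point_power a k \<Longrightarrow> f + g \<in> point_power a k"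
  unfolding point_power_def by (rule mpoly_ideal.span_add)

lemma point_power_diff: "f \<in> point_power a k \<Longrightarrow> g \<in> point_power a k \<Longrightarrow> f - g \<in> point_power a k"
  unfolding point_power_def by (rule mpoly_ideal.span_diff)

lemma coord_in_point_power: "coord a i \<in> point_power a 1"
  using prod_coord_in_point_power[of "[i]" 1 a] by simp

lemma power_in_point_power: "f \<in> point_power a 1 \<Longrightarrow> f ^ k \<in> point_power a k"
proof (induction k)
  case (Suc k)
  then show ?case using mult_in_point_power[of f a 1 "f ^ k" k] by simp
qed (simp add: point_power_0)

lemma point_power_antimono:
  assumes "j \<le> k"
  shows "point_power a k \<subseteq> point_power a j"
proof -
  have "prod_list (map (coord a) js) \<in> point_power a j" if "length js = k" for js
  proof -
    have "prod_list (map (coord a) (drop j js)) * prod_list (map (coord a) (take j js))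
        \<in> point_power a j"
      using that assms by (intro point_power_absorb prod_coord_in_point_power) simp
    then show ?thesis
      by (metis append_take_drop_id map_append mult.commute prod_list.append)
  qed
  then have "{prod_list (map (coord a) js) | js. length js = k} \<subseteq> point_power a j"
    by blast
  then show ?thesis
    unfolding point_power_def by (rule mpoly_ideal.span_minimal) (rule mpoly_ideal.subspace_span)
qed

lemma prod_single_power:
  "finite A \<Longrightarrow> (\<Prod>i\<in>A. Poly_Mapping.single (Poly_Mapping.single i 1) 1 ^ Poly_Mapping.lookup \<beta> i) =
     (Poly_Mapping.single (\<Sum>i\<in>A. Poly_Mapping.single i (Poly_Mapping.lookup \<beta> i)) 1 :: 'n::finite mpoly)"
proof (induction A rule: finite_induct)
  case (insert i A)
  have "Poly_Mapping.single (Poly_Mapping.single i 1) 1 ^ k =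
      (Poly_Mapping.single (Poly_Mapping.single i k) 1 :: 'n mpoly)" for k
    by (induction k) (simp_all add: mult_single single_add[symmetric])
  with insert show ?case by (simp add: mult_single)
qed simp

lemma single_eq_Const_mult_monomial:
  "Poly_Mapping.single \<beta> c = Const c *
     (\<Prod>i\<in>UNIV. Poly_Mapping.single (Poly_Mapping.single i 1) 1 ^ Poly_Mapping.lookup \<beta> i)"
proof -
  have "(\<Sum>i\<in>UNIV. Poly_Mapping.single i (Poly_Mapping.lookup \<beta> i)) = \<beta>"
    by (rule poly_mapping_eqI) (simp add: lookup_sum lookup_single when_def)
  then show ?thesis by (simp only: prod_single_power finite) (simp add: mult_single)
qed

text \<open>Modulo the maximal ideal of \<open>a\<close> each variable \<open>x\<^sub>i\<close> is congruent to \<open>a\<^sub>i\<close>, and congruences are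
  compatible with products and sums.\<close>

lemma diff_eval_in_point_power: "f - Const (eval_mpoly f a) \<in> point_power a 1"
proof (induction f rule: poly_mapping_single_add_induct)
  case (single \<beta> c)
  have mult: "f * g - f' * g' \<in> point_power a 1"
    if "f - f' \<in> point_power a 1" "g - g' \<in> point_power a 1" for f f' g g'
  proof -
    have "g * (f - f') + f' * (g - g') \<in> point_power a 1"
      by (intro point_power_add point_power_absorb that)
    then show ?thesis by (simp add: algebra_simps)
  qed
  have refl: "f - f \<in> point_power a 1" for f
    by (simp add: point_power_def mpoly_ideal.span_zero)
  have power: "f ^ k - g ^ k \<in> point_power a 1" if "f - g \<in> point_power a 1" for f g k
  proof (induction k)
    case 0
    show ?case using refl[of 1] by simp
  next
    case (Suc k)
    then show ?case unfolding power_Suc by (intro mult that)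
  qed
  have prod: "(\<Prod>i\<in>A. h i) - (\<Prod>i\<in>A. h' i) \<in> point_power a 1"
    if "finite A" "\<And>i. h i - h' i \<in> point_power a 1" for A :: "'a set" and h h'
    using that(1)
  proof (induction A rule: finite_induct)
    case empty
    show ?case using refl[of 1] by simp
  next
    case (insert i A)
    have "h i * (\<Prod>i\<in>A. h i) - h' i * (\<Prod>i\<in>A. h' i) \<in> point_power a 1"
      by (intro mult that(2) insert.IH)
    with insert.hyps show ?case by simp
  qed
  have "Const c * (\<Prod>i\<in>UNIV. Poly_Mapping.single (Poly_Mapping.single i 1) 1 ^ Poly_Mapping.lookup \<beta> i)
      - Const c * (\<Prod>i\<in>UNIV. Const (a $ i) ^ Poly_Mapping.lookup \<beta> i) \<in> point_power a 1"
    by (intro mult refl prod power finite) (fold coord_def, rule coord_in_point_power)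
  then show ?case
    by (simp add: single_eq_Const_mult_monomial[symmetric] Const_power prod_Const Const_mult_Const
        eval_mpoly_single del: One_nat_def)
next
  case (add f g)
  then have "(f - Const (eval_mpoly f a)) + (g - Const (eval_mpoly g a)) \<in> point_power a 1"
    by (rule point_power_add)
  then show ?case by (simp add: single_add algebra_simps)
qed

lemma in_point_power_1: "eval_mpoly f a = 0 \<Longrightarrow> f \<in> point_power a 1"
  using diff_eval_in_point_power[of f a] by simp

text \<open>The Euler operator centred at \<open>a\<close>: the derivation that multiplies a homogeneous polynomial in
  the coordinates \<open>x\<^sub>i - a\<^sub>i\<close> by its degree.\<close>

definition euler :: "real ^ 'n::finite \<Rightarrow> 'n mpoly \<Rightarrow> 'n mpoly" where
  "euler a f = (\<Sum>i\<in>UNIV. coord a i * partial i f)"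

lemma euler_in_point_power:
  assumes "\<And>i. partial i f \<in> point_power a k"
  shows "euler a f \<in> point_power a (Suc k)"
proof -
  have "coord a i * partial i f \<in> point_power a (Suc k)" for i
    using mult_in_point_power[OF coord_in_point_power[of a i] assms[of i]] by simp
  then show ?thesis
    unfolding euler_def point_power_def by (rule mpoly_ideal.span_sum)
qed

lemma euler_add: "euler a (f + g) = euler a f + euler a g"
  by (simp add: euler_def algebra_simps sum.distrib)

lemma euler_mult: "euler a (f * g) = euler a f * g + f * euler a g"
  by (simp add: euler_def algebra_simps sum.distrib sum_distrib_left sum_distrib_right)

lemma euler_coord: "euler a (coord a i) = coord a i"
  by (simp add: euler_def partial_coord if_distrib cong: if_cong)

lemma euler_prod_coord:
  "euler a (prod_list (map (coord a) js)) =
     of_nat (length js) * prod_list (map (coord a) js)"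
proof (induction js)
  case Nil
  show ?case by (simp add: euler_def)
next
  case (Cons i js)
  then show ?case by (simp add: euler_mult euler_coord algebra_simps)
qed

text \<open>For a multiple \<open>c * s\<close> of a generator, \<open>E (c * s) = E c * s + j * (c * s)\<close>; the error term
  \<open>E c * s\<close> has one factor more from the maximal ideal, because \<open>E\<close> maps every polynomial into
  it.\<close>

lemma euler_eigenvalue_mod_next_power:
  assumes "g \<in> point_power a j"
  shows "euler a g - of_nat j * g \<in> point_power a (Suc j)"
  using assms unfolding point_power_def
proof (induction rule: mpoly_ideal.span_induct_alt)
  case base
  show ?case by (simp add: euler_def mpoly_ideal.span_zero)
next
  case (step c s g)
  then obtain js where "s = prod_list (map (coord a) js)" "length js = j"
    by blast
  then have s: "euler a s = of_nat j * s" "s \<in> point_power a j"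
    by (simp_all add: euler_prod_coord prod_coord_in_point_power)
  have "euler a c \<in> point_power a 1"
    using euler_in_point_power[of c a 0] by (simp add: point_power_0)
  then have "euler a c * s \<in> point_power a (Suc j)"
    using mult_in_point_power[OF _ s(2)] by fastforce
  then have "euler a c * s + (euler a g - of_nat j * g)
      \<in> point_power a (Suc j)"
    by (rule point_power_add) (unfold point_power_def, rule step)
  then show ?case
    unfolding point_power_def[symmetric]
    by (simp add: euler_add euler_mult s algebra_simps)
qed

text \<open>The eigenvalues \<open>1, 2, \<dots>\<close> of the Euler operator are invertible constants, so knowledge about
  \<open>E f\<close> can be turned into knowledge about \<open>f\<close>. The eigenvalue 0 belongs to the constant term of
  \<open>f\<close>, which is zero because \<open>f\<close> vanishes at \<open>a\<close>.\<close>

lemma vanishing_subset_point_power: "vanishing a k \<subseteq> point_power a k"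
proof (induction k)
  case (Suc k)
  show ?case
  proof
    fix f assume f: "f \<in> vanishing a (Suc k)"
    then have euler: "euler a f \<in> point_power a (Suc k)"
      using Suc by (intro euler_in_point_power) auto
    have "f \<in> point_power a (Suc j)" if "j \<le> k" for j
      using that
    proof (induction j)
      case 0
      show ?case using f in_point_power_1[of f a] by simp
    next
      case (Suc j)
      have "euler a f - of_nat (Suc j) * f \<in> point_power a (Suc (Suc j))"
        using Suc by (intro euler_eigenvalue_mod_next_power) auto
      moreover have "euler a f \<in> point_power a (Suc (Suc j))"
        using point_power_antimono[of "Suc (Suc j)" "Suc k" a] Suc.prems euler by auto
      ultimately have "euler a f - (euler a f - of_nat (Suc j) * f) \<in> point_power a (Suc (Suc j))"
        by (rule point_power_diff[rotated])
      then have "Const (1 / real (Suc j)) * (of_nat (Suc j) * f) \<in> point_power a (Suc (Suc j))"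
        by (intro point_power_absorb[of "of_nat (Suc j) * f"]) simp
      moreover have "Const (1 / real (Suc j)) * of_nat (Suc j) = (1 :: 'a mpoly)"
        by (simp only: single_of_nat[symmetric] Const_mult_Const) simp
      ultimately show ?case
        by (simp only: mult.assoc[symmetric] mult_1_left)
    qed
    then show "f \<in> point_power a (Suc k)" by simp
  qed
qed (simp add: point_power_0)


section \<open>Several points\<close>

lemma prod_list_coord_linear:
  "\<forall>l\<in>set (map (coord a) js). is_linear l \<and> eval_mpoly l a = 0"
  by (auto simp: is_linear_coord)

lemma Suc_point_linear_product_divisible:
  assumes "f \<in> linear_product_divisible n X p"
    and "g = prod_list (map (coord (X (Suc n))) js)" "length js = p (Suc n) + 1"
  shows "g * f \<in> linear_product_divisible (Suc n) X p"
  unfolding linear_product_divisible_def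
proof (intro CollectI ballI)
  fix i assume i: "i \<in> {1..Suc n}"
  show "\<exists>ls. length ls = p i + 1 \<and> (\<forall>l\<in>set ls. is_linear l \<and> eval_mpoly l (X i) = 0) \<and>
      prod_list ls dvd g * f"
  proof (cases "i = Suc n")
    case True
    then show ?thesis
      using assms(2,3) prod_list_coord_linear[of "X (Suc n)" js]
      by (intro exI[of _ "map (coord (X (Suc n))) js"]) auto
  next
    case False
    then show ?thesis
      using assms(1) i unfolding linear_product_divisible_def by (fastforce intro: dvd_mult)
  qed
qed

text \<open>This is the source of comaximality. For each earlier point \<open>X i\<close> some coordinate separates it
  from the new point; the product of these coordinate functions, to the power \<open>p i + 1\<close>, is
  divisible as required at the earlier points and can be scaled to take the value 1 at the new
  one.\<close>

lemma exists_separating_product: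
  assumes "inj_on X {1..Suc n}"
  obtains e where "eval_mpoly e (X (Suc n)) = 1"
    and "\<And>h. h * e \<in> linear_product_divisible n X p"
proof -
  let ?b = "X (Suc n)"
  have "\<exists>c. X i $ c \<noteq> ?b $ c" if "i \<in> {1..n}" for i
  proof -
    have "X i \<noteq> ?b"
      using inj_onD[OF assms, of i "Suc n"] that by auto
    then show ?thesis by (simp add: vec_eq_iff)
  qed
  then obtain c where c: "\<And>i. i \<in> {1..n} \<Longrightarrow> X i $ c i \<noteq> ?b $ c i"
    by metis
  define e0 where "e0 = (\<Prod>i\<in>{1..n}. coord (X i) (c i) ^ (p i + 1))"
  have "eval_mpoly e0 ?b \<noteq> 0"
    using c by (force simp: e0_def)
  then have "eval_mpoly (Const (1 / eval_mpoly e0 ?b) * e0) ?b = 1"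
    by simp
  moreover have "h * (Const (1 / eval_mpoly e0 ?b) * e0) \<in> linear_product_divisible n X p" for h
    unfolding linear_product_divisible_def
  proof (intro CollectI ballI)
    fix i assume i: "i \<in> {1..n}"
    then have "coord (X i) (c i) ^ (p i + 1) dvd e0"
      unfolding e0_def by (intro dvd_prodI) auto
    then show "\<exists>ls. length ls = p i + 1 \<and> (\<forall>l\<in>set ls. is_linear l \<and> eval_mpoly l (X i) = 0) \<and>
        prod_list ls dvd h * (Const (1 / eval_mpoly e0 ?b) * e0)"
      by (intro exI[of _ "replicate (p i + 1) (coord (X i) (c i))"])
        (auto simp: is_linear_coord simp del: replicate_Suc intro!: dvd_mult)
  qed
  ultimately show thesis by (rule that)
qed

text \<open>The Chinese remainder argument, adding one point at a time. From \<open>1 = g + (1 - g)\<close>, with \<open>g\<close> in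
  the power at the new point and \<open>1 - g\<close> in the ideal of the earlier points, \<open>f = g * f + f * (1 - g)\<close>
  is a sum of two elements of the product of these ideals.\<close>

lemma in_generated_if_in_all_point_powers:
  assumes "inj_on X {1..n}" "\<forall>i\<in>{1..n}. f \<in> point_power (X i) (p i + 1)"
  shows "f \<in> mpoly_ideal_generated (linear_product_divisible n X p)"
  using assms
proof (induction n)
  case 0
  show ?case by (rule mpoly_ideal.span_base) (simp add: linear_product_divisible_def)
next
  case (Suc n)
  let ?b = "X (Suc n)" and ?k = "p (Suc n) + 1"
  let ?L = "\<lambda>n. linear_product_divisible n X p"
  obtain e where e: "eval_mpoly e ?b = 1" "\<And>h. h * e \<in> ?L n"
    using exists_separating_product[OF Suc.prems(1)] by blast
  \<comment> \<open>As \<open>1 - e\<close> vanishes at the new point, \<open>g\<close> lies in the required power there, while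
    \<open>1 - g\<close> is still divisible by \<open>e = 1 - (1 - e)\<close>.\<close>
  define g where "g = (1 - e) ^ ?k"
  have g: "g \<in> point_power ?b ?k"
    unfolding g_def using e(1) by (intro power_in_point_power in_point_power_1) simp
  have "1 - g \<in> ?L n"
    using e(2)[of "\<Sum>i<?k. (1 - e) ^ i"] one_diff_power_eq[of "1 - e" ?k]
    by (simp add: g_def mult.commute del: power_Suc)
  then have h: "1 - g \<in> mpoly_ideal_generated (?L n)"
    by (rule mpoly_ideal.span_base)
  have prod: "s * t \<in> mpoly_ideal_generated (?L (Suc n))"
    if "s \<in> point_power ?b ?k" "t \<in> mpoly_ideal_generated (?L n)" for s t
    using that unfolding point_power_def
    by (rule mult_in_generated)
      (auto intro!: mpoly_ideal.span_base Suc_point_linear_product_divisible)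
  have "f \<in> mpoly_ideal_generated (?L n)"
    using Suc by (auto simp: inj_on_def)
  then have "g * f + f * (1 - g) \<in> mpoly_ideal_generated (?L (Suc n))"
    using Suc.prems(2) by (intro mpoly_ideal.span_add prod g h) auto
  then show ?case by (simp add: algebra_simps)
qed

theorem theorem3:
  fixes X :: "nat \<Rightarrow> real ^ 'n::finite" and p :: "nat \<Rightarrow> nat" and m :: nat
  assumes "CARD('n) \<ge> 2" and "m \<ge> 2" and "inj_on X {1..m}"
  shows "fat_point_ideal m X p = mpoly_ideal_generated (linear_product_divisible m X p)"
proof
  show "fat_point_ideal m X p \<subseteq> mpoly_ideal_generated (linear_product_divisible m X p)"
  proof
    fix f assume f: "f \<in> fat_point_ideal m X p"
    have "f \<in> point_power (X i) (p i + 1)" if "i \<in> {1..m}" for i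
      using f that vanishing_subset_point_power[of "X i" "Suc (p i)"]
      unfolding fat_point_ideal_eq_vanishing by auto
    with assms(3) show "f \<in> mpoly_ideal_generated (linear_product_divisible m X p)"
      by (intro in_generated_if_in_all_point_powers) auto
  qed
next
  have "f \<in> fat_point_ideal m X p" if "f \<in> linear_product_divisible m X p" for f
    unfolding fat_point_ideal_eq_vanishing
  proof (intro CollectI ballI)
    fix i assume "i \<in> {1..m}"
    with that obtain ls where ls: "length ls = Suc (p i)" "\<forall>l\<in>set ls. eval_mpoly l (X i) = 0"
      "prod_list ls dvd f"
      unfolding linear_product_divisible_def by fastforce
    then show "f \<in> vanishing (X i) (Suc (p i))"
      using mult_in_vanishing prod_list_in_vanishing[OF ls(2)] by (metis dvd_def mult.commute)
  qed
  moreover have "mpoly_ideal.subspace (fat_point_ideal m X p)"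
    unfolding fat_point_ideal_eq_vanishing
    by (rule mpoly_ideal.subspaceI)
      (use zero_in_vanishing add_in_vanishing mult_in_vanishing in blast)+
  ultimately show "mpoly_ideal_generated (linear_product_divisible m X p) \<subseteq> fat_point_ideal m X p"
    by (intro mpoly_ideal.span_minimal) auto
qed

end
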